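(* Let $\alpha\in(0,1)$ and $\bar\sigma>0$. Suppose that $R_{k,n}(\hat\theta^{(n)})$ ($k,n\in\mathbb{N}$) are estimators for which, for some $\sigma\in(0,\bar\sigma]$, some number $z_\alpha$, with $$\hat\tau_{k,n,\theta}^2=\frac{2\sigma^4k}{n^2}+\frac{4\sigma^2\|\Pi_k\theta-\Pi_k\hat\theta^{(n)}\|^2}{n},\qquad \hat\tau_{k,n,\theta}\ge 0,$$ and for any sequences $k_n\to\infty$ and $M_n\to\infty$, $$\limsup_{n\to\infty}\sup_{\theta\in\Theta}P_\theta\Bigl(R_{k_n,n}(\hat\theta^{(n)})-\|\Pi_{k_n}\theta-\Pi_{k_n}\hat\theta^{(n)}\|^2\le -z_\alpha\hat\tau_{k_n,n,\theta}\Bigr)\le\alpha,$$ $$\lim_{n\to\infty}\sup_{\theta\in\Theta}P_\theta\Bigl(\bigl|R_{k_n,n}(\hat\theta^{(n)})-\|\Pi_{k_n}\theta-\Pi_{k_n}\hat\theta^{(n)}\|^2\bigr|\ge M_n\hat\tau_{k_n,n,\theta}\Bigr)=0.$$ Assume that $\hat\theta^{(n)}$ takes its values in $\Theta$. Let $B_k\ge0$ be given by $B_k^2=\sup_{\theta\in\Theta}\|\theta-\Pi_k\theta\|^2$. Then, for any $k_n\to\infty$, the sets $$\hat C_n=\Bigl\{\theta\in\Theta:\ \|\theta-\hat\theta^{(n)}\|\le\sqrt{z_\alpha\hat\tau_{k_n,n,\theta}+R_{k_n,n}(\hat\theta^{(n)})}+2B_{k_n}\Bigr\}$$ are honest $(1-\alpha)$-confidence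 sets for $\theta\in\Theta$, that is, $$\liminf_{n\to\infty}\inf_{\theta\in\Theta}P_\theta(\theta\in\hat C_n)\ge1-\alpha,$$ and their diameter satisfies, for any $M_n\to\infty$, $$\limsup_{n\to\infty}\sup_{\theta\in\Theta}P_\theta\Bigl(\operatorname{diam}(\hat C_n)\ge M_n\Bigl[\frac{\bar\sigma k_n^{1/4}}{\sqrt n}+B_{k_n}+\|\theta-\hat\theta^{(n)}\|\Bigr]\Bigr)=0.$$
   Context: Setting: $\Theta$ is a subset of the Hilbert space $\ell_2=\{\theta=(\theta_1,\theta_2,\dots):\sum_i\theta_i^2<\infty\}$ with norm $\|\theta\|^2=\sum_i\theta_i^2$ (the case of $\mathbb{R}^n$ with the Euclidean norm is included by appending zero coordinates). For each $n$ and each $\theta\in\Theta$, $P_\theta$ denotes the joint law, under parameter $\theta$, of an initial estimator $\hat\theta^{(n)}$ of $\theta$ and of an additional observation $X^{(n)}$ independent of $\hat\theta^{(n)}$. Each $R_{k,n}(\hat\theta^{(n)})=R_{k,n}(\hat\theta^{(n)},X^{(n)})$ is a real-valued statistic (a measurable function of the data). The projection is $\Pi_k\theta=(\theta_1,\dots,\theta_k,0,0,\dots)$. The parameter $\sigma$ may depend on the unknown $\theta$, but is then bounded by $\bar\sigma$ uniformly over $\Theta$. Convention: $\sqrt{x}:=0$ if $x<0$. Throughout $k_n$ are positive integers. Appropriate measurability of the random sets is assumed. *)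

theory Defs
  imports "HOL-Probability.Probability"
begin

text \<open>
  The real Hilbert space of square-summable sequences.  Coordinates are numbered from \<open>0\<close>,
  so \<open>ell2_nth x i\<close> is the coordinate with index \<open>i + 1\<close> in the usual notation.
\<close>

typedef ell2 = "{x :: nat \<Rightarrow> real. summable (\<lambda>i. (x i)\<^sup>2)}"
  morphisms ell2_nth Abs_ell2
  by (rule exI[of _ "\<lambda>_. 0"]) simp

setup_lifting type_definition_ell2

lemma ell2_summable: "summable (\<lambda>i. (ell2_nth x i)\<^sup>2)"
  using ell2_nth[of x] by simp

lemma ell2_eqI: "(\<And>i. ell2_nth x i = ell2_nth y i) \<Longrightarrow> x = y"
  by (metis ell2_nth_inject ext)

lemma square_summable_mult:
  fixes x y :: "nat \<Rightarrow> real"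
  assumes "summable (\<lambda>i. (x i)\<^sup>2)" "summable (\<lambda>i. (y i)\<^sup>2)"
  shows "summable (\<lambda>i. x i * y i)"
proof (rule summable_comparison_test)
  show "summable (\<lambda>i. (x i)\<^sup>2 + (y i)\<^sup>2)"
    using assms by (rule summable_add)
  have "norm (x i * y i) \<le> (x i)\<^sup>2 + (y i)\<^sup>2" for i
  proof -
    have "2 * (\<bar>x i\<bar> * \<bar>y i\<bar>) \<le> (x i)\<^sup>2 + (y i)\<^sup>2"
      using sum_squares_bound[of "\<bar>x i\<bar>" "\<bar>y i\<bar>"] by simp
    moreover have "0 \<le> \<bar>x i\<bar> * \<bar>y i\<bar>"
      by simp
    ultimately show ?thesis
      unfolding real_norm_def abs_mult by linarith
  qed
  then show "\<exists>N. \<forall>n\<ge>N. norm (x n * y n) \<le> (x n)\<^sup>2 + (y n)\<^sup>2"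
    by blast
qed

lemma square_summable_add:
  fixes x y :: "nat \<Rightarrow> real"
  assumes "summable (\<lambda>i. (x i)\<^sup>2)" "summable (\<lambda>i. (y i)\<^sup>2)"
  shows "summable (\<lambda>i. (x i + y i)\<^sup>2)"
  using summable_add[OF summable_add[OF assms] summable_mult[OF square_summable_mult[OF assms], of 2]]
  by (simp add: power2_sum mult.assoc)

instantiation ell2 :: real_vector
begin

lift_definition zero_ell2 :: ell2 is "\<lambda>_. 0" by simp

lift_definition plus_ell2 :: "ell2 \<Rightarrow> ell2 \<Rightarrow> ell2" is "\<lambda>x y i. x i + y i"
  by (rule square_summable_add)

lift_definition uminus_ell2 :: "ell2 \<Rightarrow> ell2" is "\<lambda>x i. - x i" by simp

lift_definition minus_ell2 :: "ell2 \<Rightarrow> ell2 \<Rightarrow> ell2" is "\<lambda>x y i. x i - y i"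
  using square_summable_add[of _ "\<lambda>i. - _ i"] by simp

lift_definition scaleR_ell2 :: "real \<Rightarrow> ell2 \<Rightarrow> ell2" is "\<lambda>c x i. c * x i"
  by (simp add: power_mult_distrib summable_mult)

instance
  by standard (transfer; simp add: fun_eq_iff algebra_simps)+

end

instantiation ell2 :: real_inner
begin

definition inner_ell2 :: "ell2 \<Rightarrow> ell2 \<Rightarrow> real"
  where "inner_ell2 x y = (\<Sum>i. ell2_nth x i * ell2_nth y i)"

definition norm_ell2 :: "ell2 \<Rightarrow> real"
  where "norm_ell2 x = sqrt (\<Sum>i. (ell2_nth x i)\<^sup>2)"

definition sgn_ell2 :: "ell2 \<Rightarrow> ell2"
  where "sgn_ell2 x = x /\<^sub>R norm x"

definition dist_ell2 :: "ell2 \<Rightarrow> ell2 \<Rightarrow> real"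
  where "dist_ell2 x y = norm (x - y)"

definition uniformity_ell2 :: "(ell2 \<times> ell2) filter"
  where "uniformity_ell2 = (INF e\<in>{0<..}. principal {(x, y). dist x y < e})"

definition open_ell2 :: "ell2 set \<Rightarrow> bool"
  where "open_ell2 U \<longleftrightarrow> (\<forall>x\<in>U. \<forall>\<^sub>F (x', y) in uniformity. x' = x \<longrightarrow> y \<in> U)"

instance
proof
  fix x y z :: ell2 and r :: real
  have sm: "summable (\<lambda>i. ell2_nth u i * ell2_nth v i)" for u v
    by (rule square_summable_mult[OF ell2_summable ell2_summable])
  show "dist x y = norm (x - y)" by (rule dist_ell2_def)
  show "sgn x = x /\<^sub>R norm x" by (rule sgn_ell2_def)
  show "(uniformity :: (ell2 \<times> ell2) filter) = (INF e\<in>{0<..}. principal {(x, y). dist x y < e})"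
    by (rule uniformity_ell2_def)
  show "open U \<longleftrightarrow> (\<forall>x\<in>U. \<forall>\<^sub>F (x', y) in uniformity. x' = x \<longrightarrow> y \<in> U)" for U :: "ell2 set"
    by (rule open_ell2_def)
  show "inner x y = inner y x"
    by (simp add: inner_ell2_def mult.commute)
  show "inner (x + y) z = inner x z + inner y z"
    using suminf_add[OF sm[of x z] sm[of y z]]
    by (simp add: inner_ell2_def plus_ell2.rep_eq algebra_simps)
  show "inner (r *\<^sub>R x) y = r * inner x y"
    using suminf_mult[OF sm[of x y], of r]
    by (simp add: inner_ell2_def scaleR_ell2.rep_eq algebra_simps)
  show "0 \<le> inner x x"
    by (simp add: inner_ell2_def suminf_nonneg sm)
  show "inner x x = 0 \<longleftrightarrow> x = 0"
  proof
    assume "inner x x = 0"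
    then have "ell2_nth x i * ell2_nth x i = 0" for i
      using suminf_eq_zero_iff[OF sm[of x x]] by (simp add: inner_ell2_def)
    then show "x = 0"
      by (intro ell2_eqI) (simp add: zero_ell2.rep_eq)
  qed (simp add: inner_ell2_def zero_ell2.rep_eq)
  show "norm x = sqrt (inner x x)"
    by (simp add: norm_ell2_def inner_ell2_def power2_eq_square)
qed

end

lift_definition proj :: "nat \<Rightarrow> ell2 \<Rightarrow> ell2" is "\<lambda>k x i. if i < k then x i else 0"
  subgoal for k x
    by (rule summable_comparison_test[where g = "\<lambda>i. (x i)\<^sup>2"]) auto
  done

text \<open>
  In the following two definitions \<open>t\<close> stands for the value of the initial estimator, \<open>r\<close> for
  the value of the statistic \<open>R\<close> and \<open>b\<close> for the bias bound \<open>B\<close> at \<open>k\<close>.  The parameter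
  \<open>\<sigma>\<close> is a function of the unknown \<open>\<theta>\<close>, so the member \<open>\<theta>\<close> of the confidence set
  is tested with its own \<open>\<sigma> \<theta>\<close>.
\<close>

definition tau_hat :: "(ell2 \<Rightarrow> real) \<Rightarrow> nat \<Rightarrow> nat \<Rightarrow> ell2 \<Rightarrow> ell2 \<Rightarrow> real" where
  "tau_hat \<sigma> k n \<theta> t =
     sqrt (2 * (\<sigma> \<theta>) ^ 4 * real k / (real n)\<^sup>2
           + 4 * (\<sigma> \<theta>)\<^sup>2 * (norm (proj k \<theta> - proj k t))\<^sup>2 / real n)"

text \<open>
  The library's \<^const>\<open>sqrt\<close> is odd, hence the \<^term>\<open>max 0\<close> for the convention that square
  roots of negative numbers are zero.
\<close>

definition conf_set ::
    "ell2 set \<Rightarrow> (ell2 \<Rightarrow> real) \<Rightarrow> real \<Rightarrow> nat \<Rightarrow> nat \<Rightarrow> real \<Rightarrow> ell2 \<Rightarrow> real \<Rightarrow> ell2 set" where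
  "conf_set \<Theta> \<sigma> z k n b t r =
     {\<theta> \<in> \<Theta>. norm (\<theta> - t) \<le> sqrt (max 0 (z * tau_hat \<sigma> k n \<theta> t + r)) + 2 * b}"

lemma norm_proj_diff_le: "norm (proj k x - proj k y) \<le> norm (x - y)"
proof -
  have "(\<Sum>i. (ell2_nth (proj k x - proj k y) i)\<^sup>2) \<le> (\<Sum>i. (ell2_nth (x - y) i)\<^sup>2)"
    by (rule suminf_le[OF _ ell2_summable ell2_summable])
      (simp add: minus_ell2.rep_eq proj.rep_eq)
  then show ?thesis
    by (simp add: norm_ell2_def)
qed

text \<open>
  The library's \<^const>\<open>diameter\<close> is real-valued and meaningful only for bounded sets.  The sets
  defined above are always bounded.
\<close>

lemma bounded_conf_set:
  assumes "\<And>\<theta>. \<theta> \<in> \<Theta> \<Longrightarrow> 0 < \<sigma> \<theta> \<and> \<sigma> \<theta> \<le> s"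
  shows "bounded (conf_set \<Theta> \<sigma> z k n b t r)"
proof -
  define A where "A = sqrt (2 * s ^ 4 * real k / (real n)\<^sup>2)"
  define C where "C = sqrt (4 * s\<^sup>2 / real n)"
  define D where "D = \<bar>z\<bar> * A + \<bar>r\<bar>"
  define E where "E = \<bar>z\<bar> * C"
  have nn: "0 \<le> A" "0 \<le> C" "0 \<le> D" "0 \<le> E"
    by (simp_all add: A_def C_def D_def E_def)
  have "norm (\<theta> - t) \<le> 1 + 4 * \<bar>b\<bar> + 4 * (D + E)"
    if "\<theta> \<in> conf_set \<Theta> \<sigma> z k n b t r" for \<theta>
  proof (rule ccontr)
    define x where "x = norm (\<theta> - t)"
    assume "\<not> ?thesis"
    then have x: "1 + 4 * \<bar>b\<bar> + 4 * (D + E) < x" by (simp add: x_def)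
    have "0 \<le> 4 * \<bar>b\<bar>" "0 \<le> 4 * (D + E)" using nn by simp_all
    then have x1: "1 < x" and xb: "4 * b < x" and xDE: "4 * (D + E) < x"
      using x abs_ge_self[of b] by argo+
    have s: "0 < \<sigma> \<theta>" "\<sigma> \<theta> \<le> s"
      using assms[of \<theta>] that by (auto simp: conf_set_def)
    have "tau_hat \<sigma> k n \<theta> t \<le> sqrt (2 * s ^ 4 * real k / (real n)\<^sup>2 + 4 * s\<^sup>2 * x\<^sup>2 / real n)"
      unfolding tau_hat_def x_def using s
      by (intro real_sqrt_le_mono add_mono divide_right_mono mult_mono power_mono norm_proj_diff_le)
        auto
    also have "\<dots> \<le> A + sqrt (4 * s\<^sup>2 * x\<^sup>2 / real n)"
      unfolding A_def by (rule sqrt_add_le_add_sqrt) auto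
    also have "sqrt (4 * s\<^sup>2 * x\<^sup>2 / real n) = C * x"
      using x1 by (simp add: C_def real_sqrt_mult real_sqrt_divide)
    finally have tau: "tau_hat \<sigma> k n \<theta> t \<le> A + C * x" .
    have "0 \<le> tau_hat \<sigma> k n \<theta> t"
      by (simp add: tau_hat_def)
    then have "z * tau_hat \<sigma> k n \<theta> t \<le> \<bar>z\<bar> * (A + C * x)"
      using tau by (intro mult_mono) auto
    then have "max 0 (z * tau_hat \<sigma> k n \<theta> t + r) \<le> D + E * x"
      using nn x1 by (auto simp: D_def E_def algebra_simps)
    also have "\<dots> \<le> (D + E) * x"
      using mult_left_mono[of 1 x D] nn x1 by (simp add: algebra_simps)
    finally have "sqrt (max 0 (z * tau_hat \<sigma> k n \<theta> t + r)) \<le> sqrt ((D + E) * x)"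
      by (rule real_sqrt_le_mono)
    moreover have "x \<le> sqrt (max 0 (z * tau_hat \<sigma> k n \<theta> t + r)) + 2 * b"
      using that by (simp add: conf_set_def x_def)
    ultimately have "x / 2 \<le> sqrt ((D + E) * x)"
      using xb by argo
    then have "(x / 2)\<^sup>2 \<le> (D + E) * x"
      using power_mono[of "x / 2" "sqrt ((D + E) * x)" 2] x1 nn by simp
    then have "x * x \<le> (4 * (D + E)) * x"
      by (simp add: power2_eq_square algebra_simps)
    then have "x \<le> 4 * (D + E)"
      using x1 by (simp add: mult_le_cancel_right)
    with xDE show False by linarith
  qed
  then show ?thesis
    unfolding bounded_any_center[where a = t]
    by (intro exI[of _ "1 + 4 * \<bar>b\<bar> + 4 * (D + E)"]) (simp add: dist_norm norm_minus_commute)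
qed

end

theory Submission
  imports Defs
begin

text \<open>
  Both claims reduce to deterministic statements about one realisation \<open>t\<close> of the initial
  estimator and one value \<open>r\<close> of the statistic.

  Coverage: two points of \<open>\<Theta>\<close> differ from their projections by at most \<open>B\<close>, so
  \<open>\<parallel>\<theta> - t\<parallel>\<close> exceeds \<open>\<parallel>\<Pi>\<theta> - \<Pi>t\<parallel>\<close> by at most \<open>2 * B\<close>, and that is why \<open>2 * B\<close> is added to the
  radius.  Hence \<open>\<theta>\<close> can be missed only if \<open>r - \<parallel>\<Pi>\<theta> - \<Pi>t\<parallel>\<^sup>2\<close> is at most \<open>- z * \<tau>\<close>
  (lemma \<open>mem_conf_setI\<close>), an event whose probability is asymptotically at most \<open>\<alpha>\<close>, uniformly
  in \<open>\<theta>\<close>.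

  Diameter: write \<open>a = \<sigma>bar * k powr (1/4) / sqrt n\<close> and \<open>D = a + B + \<parallel>\<theta> - t\<parallel>\<close>.  The
  standard deviation \<open>\<tau>\<close> at a parameter at distance \<open>x\<close> from \<open>t\<close> is at most \<open>2 * a * (a + x)\<close>
  (lemma \<open>tau_hat_le\<close>).  Unless \<open>\<bar>r - \<parallel>\<Pi>\<theta> - \<Pi>t\<parallel>\<^sup>2\<bar> \<ge> s\<^sup>2 * \<tau>\<close>, the statistic \<open>r\<close> is
  therefore at most a multiple of \<open>s\<^sup>2 * D\<^sup>2\<close>.  A member of the confidence set at distance \<open>y\<close> from
  \<open>t\<close> then satisfies an inequality \<open>y \<le> sqrt (c * 2 * a * (a + y) + r) + 2 * B\<close> whose right-hand
  side grows only like \<open>sqrt y\<close>; solving it gives \<open>y \<le> s * const * D\<close> (lemmas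
  \<open>radius_inequality\<close> and \<open>diameter_conf_set_le\<close>).  With \<open>s\<close> a small constant times \<open>M\<close>,
  the diameter can reach \<open>M * D\<close> only on the exceptional event, whose
  probability tends to \<open>0\<close> because \<open>s\<^sup>2\<close> tends to infinity with \<open>M\<close>.
\<close>

section \<open>Measurability\<close>

lemma continuous_on_proj: "continuous_on A (proj k)"
  by (intro continuous_onI)
    (metis dist_norm norm_proj_diff_le order_le_less_trans less_imp_le)

lemma continuous_on_tau_hat: "continuous_on UNIV (tau_hat \<sigma> k n \<theta>)"
  unfolding tau_hat_def divide_inverse by (intro continuous_intros continuous_on_proj)

lemma borel_measurable_tau_hat [measurable]: "tau_hat \<sigma> k n \<theta> \<in> borel_measurable borel"
  by (rule borel_measurable_continuous_onI[OF continuous_on_tau_hat])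

lemma borel_measurable_norm_proj_diff [measurable]:
  "(\<lambda>t. norm (proj k \<theta> - proj k t)) \<in> borel_measurable borel"
  by (intro borel_measurable_continuous_onI continuous_intros continuous_on_proj)

lemma borel_measurable_norm_diff_const [measurable]:
  fixes \<theta> :: ell2
  shows "(\<lambda>t. norm (\<theta> - t)) \<in> borel_measurable borel"
  by (intro borel_measurable_continuous_onI continuous_intros)

section \<open>Coverage for a single realisation\<close>

text \<open>
  The bias bound is used twice, once for \<open>\<theta>\<close> and once for \<open>t\<close>, which accounts for the
  summand \<open>2 * b\<close> in the radius.
\<close>

lemma mem_conf_setI:
  assumes "\<theta> \<in> \<Theta>"
    and bias: "norm (\<theta> - proj k \<theta>) \<le> b" "norm (t - proj k t) \<le> b"
    and above: "- z * tau_hat \<sigma> k n \<theta> t < r - (norm (proj k \<theta> - proj k t))\<^sup>2"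
  shows "\<theta> \<in> conf_set \<Theta> \<sigma> z k n b t r"
proof -
  have "norm (\<theta> - t)
      = norm ((\<theta> - proj k \<theta>) + (proj k \<theta> - proj k t) - (t - proj k t))"
    by (simp add: algebra_simps)
  also have "\<dots> \<le> norm (\<theta> - proj k \<theta>) + norm (proj k \<theta> - proj k t) + norm (t - proj k t)"
    by (meson norm_triangle_ineq4 norm_triangle_ineq add_right_mono order_trans)
  also have "\<dots> \<le> norm (proj k \<theta> - proj k t) + 2 * b"
    using bias by simp
  also have "norm (proj k \<theta> - proj k t) \<le> sqrt (max 0 (z * tau_hat \<sigma> k n \<theta> t + r))"
    using above by (intro real_le_rsqrt) simp
  finally show ?thesis
    using assms(1) by (simp add: conf_set_def)
qed

section \<open>The diameter for a single realisation\<close>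

text \<open>
  The factor \<open>k powr (1/4)\<close> makes \<open>2 * a ^ 4\<close> a bound for the first summand of \<open>tau_hat\<^sup>2\<close>,
  with equality if \<open>\<sigma> \<theta> = s\<close>.  Since \<open>1 \<le> k\<close>, also \<open>s / sqrt n \<le> a\<close>, which bounds the second
  summand by \<open>4 * a\<^sup>2 * \<parallel>\<theta> - t\<parallel>\<^sup>2\<close>.
\<close>

lemma tau_hat_le:
  assumes "0 < k" and \<sigma>: "0 \<le> \<sigma> \<theta>" "\<sigma> \<theta> \<le> s"
    and a: "a = s * real k powr (1/4) / sqrt (real n)"
  shows "tau_hat \<sigma> k n \<theta> t \<le> 2 * a * (a + norm (\<theta> - t))"
proof -
  define w where "w = real k powr (1/4)"
  define y where "y = norm (\<theta> - t)"
  have w: "1 \<le> w" "w ^ 4 = real k"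
    using \<open>0 < k\<close> by (auto simp: w_def powr_power ge_one_powr_ge_zero)
  have a': "a = s * w / sqrt (real n)" by (simp add: a w_def)
  have nn: "0 \<le> a" "0 \<le> y" using \<sigma> w by (simp_all add: a' y_def)
  have "sqrt (real n) ^ 4 = (real n)\<^sup>2"
    using power_mult[of "sqrt (real n)" 2 2] by simp
  then have a4: "a ^ 4 = s ^ 4 * real k / (real n)\<^sup>2"
    by (simp add: a' power_divide power_mult_distrib w)
  have a2: "s\<^sup>2 / real n \<le> a\<^sup>2"
    using w by (simp add: a' power_divide power_mult_distrib divide_right_mono mult_left_le
        mult_le_cancel_left1 one_le_power)
  have "2 * (\<sigma> \<theta>) ^ 4 * real k / (real n)\<^sup>2 \<le> 2 * s ^ 4 * real k / (real n)\<^sup>2"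
    using \<sigma> by (intro divide_right_mono mult_mono power_mono) auto
  moreover have "4 * (\<sigma> \<theta>)\<^sup>2 * (norm (proj k \<theta> - proj k t))\<^sup>2 / real n \<le> 4 * s\<^sup>2 * y\<^sup>2 / real n"
    unfolding y_def using \<sigma>
    by (intro divide_right_mono mult_mono power_mono norm_proj_diff_le) auto
  moreover have "4 * s\<^sup>2 * y\<^sup>2 / real n \<le> 4 * (a\<^sup>2 * y\<^sup>2)"
    using mult_right_mono[OF a2, of "y\<^sup>2"] by simp
  moreover have "2 * a ^ 4 + 4 * (a\<^sup>2 * y\<^sup>2) \<le> (2 * a * (a + y))\<^sup>2"
  proof -
    have "(2 * a * (a + y))\<^sup>2 = 2 * a ^ 4 + 4 * (a\<^sup>2 * y\<^sup>2) + (2 * a ^ 4 + 8 * a ^ 3 * y)"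
      by (simp add: power2_eq_square power3_eq_cube power4_eq_xxxx algebra_simps)
    moreover have "0 \<le> 2 * a ^ 4 + 8 * a ^ 3 * y"
      using nn by simp
    ultimately show ?thesis by linarith
  qed
  ultimately show ?thesis
    unfolding tau_hat_def y_def[symmetric] using nn a4
    by (intro real_le_lsqrt) auto
qed

text \<open>
  If \<open>y\<close> exceeded the claimed bound, then \<open>D\<close> would be so small compared with \<open>y\<close> that the
  square root is at most \<open>7/16 * y\<close> and \<open>2 * b\<close> at most \<open>y / 4\<close>, which add up to less than \<open>y\<close>.
\<close>

lemma radius_inequality:
  fixes a b x y c s :: real
  assumes "0 \<le> c" "1 \<le> s" "0 \<le> a" "0 \<le> b" "0 \<le> x"
    and y: "y \<le> sqrt (max 0 (c * (2 * a * (a + y)) + (x\<^sup>2 + s\<^sup>2 * (2 * a * (a + x))))) + 2 * b"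
  shows "y \<le> s * (16 * c + 8) * (a + b + x)"
proof (rule ccontr)
  define D where "D = a + b + x"
  have D: "0 \<le> D" "a \<le> D" "b \<le> D" "x \<le> D" "a + x \<le> D"
    using assms by (simp_all add: D_def)
  assume "\<not> ?thesis"
  then have big: "16 * (s * c * D) + 8 * (s * D) < y"
    by (simp add: D_def algebra_simps)
  have "0 \<le> c * D" "c * D \<le> s * (c * D)" "D \<le> s * D"
    using assms D mult_right_mono[of 1 s "c * D"] mult_right_mono[of 1 s D] by auto
  then have cD: "16 * (c * D) \<le> y" and sD: "8 * (s * D) \<le> y" and D8: "8 * D \<le> y" and "0 < y"
    using big D(1) by (auto simp: algebra_simps)
  have "c * (2 * a * (a + y)) \<le> c * (2 * D * (D + y))"
    using assms D \<open>0 < y\<close> by (intro mult_left_mono mult_mono) auto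
  also have "\<dots> = 2 * (c * D) * (D + y)" by simp
  also have "\<dots> \<le> 2 * (y / 16) * (y / 8 + y)"
    using cD D8 D assms \<open>0 < y\<close> by (intro mult_mono) auto
  finally have 1: "c * (2 * a * (a + y)) \<le> 9 / 64 * y\<^sup>2"
    by (simp add: power2_eq_square)
  have "x\<^sup>2 \<le> (s * D)\<^sup>2"
    using \<open>D \<le> s * D\<close> D assms by (intro power_mono) auto
  moreover have "s\<^sup>2 * (2 * a * (a + x)) \<le> s\<^sup>2 * (2 * D * D)"
    using assms D by (intro mult_left_mono mult_mono) auto
  moreover have "(s * D)\<^sup>2 \<le> (y / 8)\<^sup>2"
    using sD D assms by (intro power_mono) auto
  moreover have "s\<^sup>2 * (2 * D * D) = 2 * (s * D)\<^sup>2" "(y / 8)\<^sup>2 = y\<^sup>2 / 64"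
    by (simp_all add: power2_eq_square)
  ultimately have 2: "x\<^sup>2 + s\<^sup>2 * (2 * a * (a + x)) \<le> 3 / 64 * y\<^sup>2"
    by linarith
  have "sqrt (max 0 (c * (2 * a * (a + y)) + (x\<^sup>2 + s\<^sup>2 * (2 * a * (a + x))))) \<le> 7 / 16 * y"
  proof (rule real_le_lsqrt)
    have "(7 / 16 * y)\<^sup>2 = 49 / 256 * y\<^sup>2"
      by (simp add: power2_eq_square)
    then show "max 0 (c * (2 * a * (a + y)) + (x\<^sup>2 + s\<^sup>2 * (2 * a * (a + x)))) \<le> (7 / 16 * y)\<^sup>2"
      using 1 2 zero_le_power2[of y] by linarith
  qed (use \<open>0 < y\<close> in simp)
  then show False
    using y D8 D(3) \<open>0 < y\<close> by linarith
qed

text \<open>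
  Closeness of \<open>r\<close> at the single parameter \<open>\<theta>\<close> bounds \<open>r\<close> from above, and this one bound
  limits all members of the set at once: each is tested with its own \<open>\<sigma>\<close>, but
  \<open>\<sigma>bar\<close> bounds them all.  The radius inequality then confines the set to a ball around \<open>t\<close>.
\<close>

lemma diameter_conf_set_le:
  assumes \<sigma>: "\<And>\<theta>. \<theta> \<in> \<Theta> \<Longrightarrow> 0 < \<sigma> \<theta> \<and> \<sigma> \<theta> \<le> \<sigma>bar"
    and "\<theta> \<in> \<Theta>" "0 < k" "0 \<le> b" "1 \<le> s"
    and a: "a = \<sigma>bar * real k powr (1/4) / sqrt (real n)"
    and close: "\<bar>r - (norm (proj k \<theta> - proj k t))\<^sup>2\<bar> < s\<^sup>2 * tau_hat \<sigma> k n \<theta> t"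
  shows "diameter (conf_set \<Theta> \<sigma> z k n b t r)
    \<le> s * (32 * \<bar>z\<bar> + 16) * (a + b + norm (\<theta> - t))"
proof -
  define x where "x = norm (\<theta> - t)"
  define L where "L = s * (16 * \<bar>z\<bar> + 8) * (a + b + x)"
  have a0: "0 \<le> a" using \<sigma>[OF \<open>\<theta> \<in> \<Theta>\<close>] by (simp add: a)
  have x0: "0 \<le> x" by (simp add: x_def)
  have tau: "tau_hat \<sigma> k n \<theta>' t \<le> 2 * a * (a + norm (\<theta>' - t))" if "\<theta>' \<in> \<Theta>" for \<theta>'
    using tau_hat_le[OF \<open>0 < k\<close> _ _ a] \<sigma>[OF that] by auto
  have "(norm (proj k \<theta> - proj k t))\<^sup>2 \<le> x\<^sup>2"
    unfolding x_def by (intro power_mono norm_proj_diff_le) simp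
  moreover have "s\<^sup>2 * tau_hat \<sigma> k n \<theta> t \<le> s\<^sup>2 * (2 * a * (a + x))"
    using tau[OF \<open>\<theta> \<in> \<Theta>\<close>] by (intro mult_left_mono) (simp_all add: x_def)
  ultimately have r: "r \<le> x\<^sup>2 + s\<^sup>2 * (2 * a * (a + x))"
    using close by linarith
  have radius: "norm (\<theta>' - t) \<le> L" if "\<theta>' \<in> conf_set \<Theta> \<sigma> z k n b t r" for \<theta>'
  proof -
    define y where "y = norm (\<theta>' - t)"
    have "0 \<le> tau_hat \<sigma> k n \<theta>' t" by (simp add: tau_hat_def)
    then have "z * tau_hat \<sigma> k n \<theta>' t \<le> \<bar>z\<bar> * (2 * a * (a + y))"
      using tau[of \<theta>'] that by (intro mult_mono) (auto simp: conf_set_def y_def)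
    then have "sqrt (max 0 (z * tau_hat \<sigma> k n \<theta>' t + r))
        \<le> sqrt (max 0 (\<bar>z\<bar> * (2 * a * (a + y)) + (x\<^sup>2 + s\<^sup>2 * (2 * a * (a + x)))))"
      using r by (intro real_sqrt_le_mono) linarith
    moreover have "y \<le> sqrt (max 0 (z * tau_hat \<sigma> k n \<theta>' t + r)) + 2 * b"
      using that by (simp add: conf_set_def y_def)
    ultimately have "y \<le> sqrt (max 0 (\<bar>z\<bar> * (2 * a * (a + y))
        + (x\<^sup>2 + s\<^sup>2 * (2 * a * (a + x))))) + 2 * b"
      by linarith
    then have "y \<le> L"
      unfolding L_def using a0 x0 \<open>0 \<le> b\<close> \<open>1 \<le> s\<close> by (intro radius_inequality) auto
    then show ?thesis by (simp add: y_def)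
  qed
  have "diameter (conf_set \<Theta> \<sigma> z k n b t r) \<le> 2 * L"
  proof (rule diameter_le)
    show "conf_set \<Theta> \<sigma> z k n b t r \<noteq> {} \<or> 0 \<le> 2 * L"
      using assms a0 x0 by (simp add: L_def)
    fix u v assume "u \<in> conf_set \<Theta> \<sigma> z k n b t r" "v \<in> conf_set \<Theta> \<sigma> z k n b t r"
    then show "norm (u - v) \<le> 2 * L"
      using radius[of u] radius[of v] norm_triangle_ineq4[of "u - t" "v - t"] by simp
  qed
  then show ?thesis by (simp add: L_def x_def algebra_simps)
qed

section \<open>Honesty and diameter of the confidence sets\<close>

theorem proposition2p1:
  fixes \<Theta> :: "ell2 set"
    and S :: "nat \<Rightarrow> 'w measure" and P :: "nat \<Rightarrow> ell2 \<Rightarrow> 'w measure"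
    and XS :: "nat \<Rightarrow> 'x measure"
    and \<theta>hat :: "nat \<Rightarrow> 'w \<Rightarrow> ell2" and X :: "nat \<Rightarrow> 'w \<Rightarrow> 'x"
    and R :: "nat \<Rightarrow> nat \<Rightarrow> ell2 \<Rightarrow> 'x \<Rightarrow> real"
    and \<alpha> \<sigma>bar z :: real and \<sigma> :: "ell2 \<Rightarrow> real" and B :: "nat \<Rightarrow> real" and k :: "nat \<Rightarrow> nat"
  assumes alpha: "0 < \<alpha>" "\<alpha> < 1"
    and sigmabar: "0 < \<sigma>bar"
    and sigma: "\<And>\<theta>. \<theta> \<in> \<Theta> \<Longrightarrow> 0 < \<sigma> \<theta> \<and> \<sigma> \<theta> \<le> \<sigma>bar"
    \<comment> \<open>statistical model: sample spaces \<open>S n\<close> with laws \<open>P n \<theta>\<close>\<close>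
    and prob: "\<And>n \<theta>. \<theta> \<in> \<Theta> \<Longrightarrow> prob_space (P n \<theta>)"
    and sets_P: "\<And>n \<theta>. \<theta> \<in> \<Theta> \<Longrightarrow> sets (P n \<theta>) = sets (S n)"
    and thetahat_meas: "\<And>n. \<theta>hat n \<in> S n \<rightarrow>\<^sub>M borel"
    and X_meas: "\<And>n. X n \<in> S n \<rightarrow>\<^sub>M XS n"
    and indep: "\<And>n \<theta>. \<theta> \<in> \<Theta> \<Longrightarrow>
      distr (P n \<theta>) (borel \<Otimes>\<^sub>M XS n) (\<lambda>\<omega>. (\<theta>hat n \<omega>, X n \<omega>)) =
      distr (P n \<theta>) borel (\<theta>hat n) \<Otimes>\<^sub>M distr (P n \<theta>) (XS n) (X n)"
    and R_meas: "\<And>k n. (\<lambda>(t, x). R k n t x) \<in> borel \<Otimes>\<^sub>M XS n \<rightarrow>\<^sub>M borel"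
    and thetahat_in: "\<And>n \<omega>. \<omega> \<in> space (S n) \<Longrightarrow> \<theta>hat n \<omega> \<in> \<Theta>"
    and R_lower: "\<And>k. (\<And>n. 0 < k n) \<Longrightarrow> filterlim k at_top sequentially \<Longrightarrow>
      limsup (\<lambda>n. SUP \<theta>\<in>\<Theta>. ereal (measure (P n \<theta>) {\<omega> \<in> space (S n).
        R (k n) n (\<theta>hat n \<omega>) (X n \<omega>) - (norm (proj (k n) \<theta> - proj (k n) (\<theta>hat n \<omega>)))\<^sup>2
          \<le> - z * tau_hat \<sigma> (k n) n \<theta> (\<theta>hat n \<omega>)})) \<le> ereal \<alpha>"
    and R_tight: "\<And>k M. (\<And>n. 0 < k n) \<Longrightarrow> filterlim k at_top sequentially \<Longrightarrow>
      filterlim M at_top sequentially \<Longrightarrow>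
      (\<lambda>n. SUP \<theta>\<in>\<Theta>. ereal (measure (P n \<theta>) {\<omega> \<in> space (S n).
        \<bar>R (k n) n (\<theta>hat n \<omega>) (X n \<omega>) - (norm (proj (k n) \<theta> - proj (k n) (\<theta>hat n \<omega>)))\<^sup>2\<bar>
          \<ge> M n * tau_hat \<sigma> (k n) n \<theta> (\<theta>hat n \<omega>)})) \<longlonglongrightarrow> 0"
    \<comment> \<open>\<open>B k\<close> need only be finite for large \<open>k\<close>, so that \<open>\<Theta>\<close> may be an unbounded subset of some
      \<open>\<real>\<^sup>m\<close>; its values for other \<open>k\<close> are irrelevant\<close>
    and B: "\<forall>\<^sub>F k in sequentially. 0 \<le> B k \<and>
      ereal ((B k)\<^sup>2) = (SUP \<theta>\<in>\<Theta>. ereal ((norm (\<theta> - proj k \<theta>))\<^sup>2))"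
    and k_pos: "\<And>n. 0 < k n"
    and k_lim: "filterlim k at_top sequentially"
    and diam_meas: "\<And>n. (\<lambda>\<omega>. diameter (conf_set \<Theta> \<sigma> z (k n) n (B (k n)) (\<theta>hat n \<omega>)
      (R (k n) n (\<theta>hat n \<omega>) (X n \<omega>)))) \<in> S n \<rightarrow>\<^sub>M borel"
  shows "(liminf (\<lambda>n. INF \<theta>\<in>\<Theta>. ereal (measure (P n \<theta>) {\<omega> \<in> space (S n).
      \<theta> \<in> conf_set \<Theta> \<sigma> z (k n) n (B (k n)) (\<theta>hat n \<omega>) (R (k n) n (\<theta>hat n \<omega>) (X n \<omega>))}))
      \<ge> ereal (1 - \<alpha>)) \<and>
    (\<forall>M. filterlim M at_top sequentially \<longrightarrow>
      limsup (\<lambda>n. SUP \<theta>\<in>\<Theta>. ereal (measure (P n \<theta>) {\<omega> \<in> space (S n).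
        diameter (conf_set \<Theta> \<sigma> z (k n) n (B (k n)) (\<theta>hat n \<omega>) (R (k n) n (\<theta>hat n \<omega>) (X n \<omega>)))
          \<ge> M n * (\<sigma>bar * real (k n) powr (1/4) / sqrt (real n) + B (k n) + norm (\<theta> - \<theta>hat n \<omega>))}))
      = 0)"
proof (intro conjI allI impI)
  define C where "C n \<omega> = conf_set \<Theta> \<sigma> z (k n) n (B (k n)) (\<theta>hat n \<omega>)
      (R (k n) n (\<theta>hat n \<omega>) (X n \<omega>))" for n \<omega>
  define Y where "Y n \<theta> \<omega> = R (k n) n (\<theta>hat n \<omega>) (X n \<omega>)
      - (norm (proj (k n) \<theta> - proj (k n) (\<theta>hat n \<omega>)))\<^sup>2" for n \<theta> \<omega>
  define T where "T n \<theta> \<omega> = tau_hat \<sigma> (k n) n \<theta> (\<theta>hat n \<omega>)" for n \<theta> \<omega>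
  note [measurable] = thetahat_meas X_meas
  have R_comp [measurable]:
    "(\<lambda>\<omega>. R (k n) n (\<theta>hat n \<omega>) (X n \<omega>)) \<in> borel_measurable (S n)" for n
    using measurable_compose[OF measurable_Pair[OF thetahat_meas X_meas] R_meas] by simp
  have Y_meas [measurable]: "Y n \<theta> \<in> borel_measurable (S n)" for n \<theta>
    unfolding Y_def by measurable
  have T_meas [measurable]: "T n \<theta> \<in> borel_measurable (S n)" for n \<theta>
    unfolding T_def by measurable
  have bias: "\<forall>\<^sub>F n in sequentially. 0 \<le> B (k n) \<and>
      (\<forall>\<theta>\<in>\<Theta>. norm (\<theta> - proj (k n) \<theta>) \<le> B (k n))"
  proof (rule eventually_mono[OF eventually_compose_filterlim[OF B k_lim]], intro conjI ballI)
    fix n \<theta>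
    assume Bn: "0 \<le> B (k n) \<and>
        ereal ((B (k n))\<^sup>2) = (SUP \<theta>\<in>\<Theta>. ereal ((norm (\<theta> - proj (k n) \<theta>))\<^sup>2))"
    then show "0 \<le> B (k n)" by simp
    assume "\<theta> \<in> \<Theta>"
    then have "ereal ((norm (\<theta> - proj (k n) \<theta>))\<^sup>2) \<le> ereal ((B (k n))\<^sup>2)"
      unfolding conjunct2[OF Bn] by (rule SUP_upper)
    then show "norm (\<theta> - proj (k n) \<theta>) \<le> B (k n)"
      unfolding ereal_less_eq using conjunct1[OF Bn] by (rule power2_le_imp_le)
  qed
  \<comment> \<open>The supremum over an empty parameter set would be \<open>-\<infinity>\<close>, not the square of a real number.\<close>
  have "\<Theta> \<noteq> {}"
    using eventually_happens[OF B] by (auto simp: bot_ereal_def)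

  show "ereal (1 - \<alpha>) \<le> liminf (\<lambda>n. INF \<theta>\<in>\<Theta>. ereal (measure (P n \<theta>) {\<omega> \<in> space (S n).
      \<theta> \<in> conf_set \<Theta> \<sigma> z (k n) n (B (k n)) (\<theta>hat n \<omega>) (R (k n) n (\<theta>hat n \<omega>) (X n \<omega>))}))"
    unfolding C_def[symmetric]
  proof -
    define q where "q n = (SUP \<theta>\<in>\<Theta>. ereal (measure (P n \<theta>)
        {\<omega> \<in> space (S n). Y n \<theta> \<omega> \<le> - z * T n \<theta> \<omega>}))" for n
    have q: "limsup q \<le> ereal \<alpha>"
      using R_lower[OF k_pos k_lim] by (simp add: q_def[abs_def] Y_def T_def)
    have "\<forall>\<^sub>F n in sequentially. ereal 1 - q n
        \<le> (INF \<theta>\<in>\<Theta>. ereal (measure (P n \<theta>) {\<omega> \<in> space (S n). \<theta> \<in> C n \<omega>}))"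
    proof (rule eventually_mono[OF bias], rule INF_greatest)
      fix n \<theta>
      assume bn: "0 \<le> B (k n) \<and> (\<forall>\<theta>\<in>\<Theta>. norm (\<theta> - proj (k n) \<theta>) \<le> B (k n))"
        and "\<theta> \<in> \<Theta>"
      interpret prob_space "P n \<theta>" by (rule prob[OF \<open>\<theta> \<in> \<Theta>\<close>])
      note sets = sets_P[OF \<open>\<theta> \<in> \<Theta>\<close>, of n] and space = sets_eq_imp_space_eq[OF sets_P[OF \<open>\<theta> \<in> \<Theta>\<close>, of n]]
      define bad where "bad = {\<omega> \<in> space (S n). Y n \<theta> \<omega> \<le> - z * T n \<theta> \<omega>}"
      have "bad \<in> sets (S n)"
        unfolding bad_def by measurable
      then have bad: "bad \<in> events" by (simp add: sets)
      \<comment> \<open>Covering \<open>\<theta>\<close> is a condition on \<open>norm (\<theta> - \<theta>hat n \<omega>)\<close> with the radius at \<open>\<theta>\<close> itself, hence an event.\<close>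
      have "{\<omega> \<in> space (S n). norm (\<theta> - \<theta>hat n \<omega>)
          \<le> sqrt (max 0 (z * T n \<theta> \<omega> + R (k n) n (\<theta>hat n \<omega>) (X n \<omega>))) + 2 * B (k n)} \<in> sets (S n)"
        by measurable
      then have cov: "{\<omega> \<in> space (S n). \<theta> \<in> C n \<omega>} \<in> events"
        using \<open>\<theta> \<in> \<Theta>\<close> by (simp add: C_def conf_set_def T_def sets)
      have "space (P n \<theta>) - bad \<subseteq> {\<omega> \<in> space (S n). \<theta> \<in> C n \<omega>}"
        using bn \<open>\<theta> \<in> \<Theta>\<close> thetahat_in
        by (auto simp: bad_def C_def Y_def T_def space intro!: mem_conf_setI)
      then have "1 - prob bad \<le> prob {\<omega> \<in> space (S n). \<theta> \<in> C n \<omega>}"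
        using finite_measure_mono[OF _ cov] prob_compl[OF bad] by metis
      moreover have "ereal (prob bad) \<le> q n"
        unfolding q_def bad_def using \<open>\<theta> \<in> \<Theta>\<close> by (rule SUP_upper)
      then have "ereal 1 - q n \<le> ereal 1 - ereal (prob bad)"
        by (intro ereal_minus_mono) auto
      ultimately show "ereal 1 - q n \<le> ereal (prob {\<omega> \<in> space (S n). \<theta> \<in> C n \<omega>})"
        by (simp add: order_trans one_ereal_def)
    qed
    then have "liminf (\<lambda>n. ereal 1 - q n)
        \<le> liminf (\<lambda>n. INF \<theta>\<in>\<Theta>. ereal (measure (P n \<theta>) {\<omega> \<in> space (S n). \<theta> \<in> C n \<omega>}))"
      by (rule Liminf_mono)
    moreover have "liminf (\<lambda>n. ereal 1 - q n) = ereal 1 - limsup q"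
      by (rule liminf_ereal_cminus) simp
    moreover have "ereal (1 - \<alpha>) \<le> ereal 1 - limsup q"
      using ereal_minus_mono[OF order_refl q, of "ereal 1"] by simp
    ultimately show "ereal (1 - \<alpha>)
        \<le> liminf (\<lambda>n. INF \<theta>\<in>\<Theta>. ereal (measure (P n \<theta>) {\<omega> \<in> space (S n). \<theta> \<in> C n \<omega>}))"
      by simp
  qed

  fix M :: "nat \<Rightarrow> real"
  assume M: "filterlim M at_top sequentially"
  define D where "D n \<theta> \<omega> = \<sigma>bar * real (k n) powr (1/4) / sqrt (real n) + B (k n)
      + norm (\<theta> - \<theta>hat n \<omega>)" for n \<theta> \<omega>
  \<comment> \<open>\<open>17\<close> instead of the \<open>16\<close> of the diameter bound makes that bound strictly less than \<open>M n * D\<close>.\<close>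
  define s where "s n = M n / (32 * \<bar>z\<bar> + 17)" for n
  have s: "filterlim s at_top sequentially"
    unfolding s_def[abs_def] divide_inverse
    by (rule filterlim_at_top_mult_tendsto_pos[OF tendsto_const _ M]) simp
  have s2: "filterlim (\<lambda>n. (s n)\<^sup>2) at_top sequentially"
    by (rule filterlim_pow_at_top[OF _ s]) simp
  define q where "q n = (SUP \<theta>\<in>\<Theta>. ereal (measure (P n \<theta>)
      {\<omega> \<in> space (S n). \<bar>Y n \<theta> \<omega>\<bar> \<ge> (s n)\<^sup>2 * T n \<theta> \<omega>}))" for n
  define p where "p n = (SUP \<theta>\<in>\<Theta>. ereal (measure (P n \<theta>)
      {\<omega> \<in> space (S n). diameter (C n \<omega>) \<ge> M n * D n \<theta> \<omega>}))" for n
  have q: "q \<longlonglongrightarrow> 0"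
    using R_tight[OF k_pos k_lim s2] by (simp add: q_def[abs_def] Y_def T_def)
  have "\<forall>\<^sub>F n in sequentially. p n \<le> q n"
    using bias eventually_gt_at_top[of 0] s[unfolded filterlim_at_top, rule_format, of 1]
  proof eventually_elim
    fix n
    assume bn: "0 \<le> B (k n) \<and> (\<forall>\<theta>\<in>\<Theta>. norm (\<theta> - proj (k n) \<theta>) \<le> B (k n))"
      and n: "0 < n" and sn: "1 \<le> s n"
    show "p n \<le> q n"
      unfolding p_def q_def
    proof (rule SUP_mono, rule bexI)
      fix \<theta> assume "\<theta> \<in> \<Theta>"
      then show "\<theta> \<in> \<Theta>" .
      interpret prob_space "P n \<theta>" by (rule prob[OF \<open>\<theta> \<in> \<Theta>\<close>])
      have "{\<omega> \<in> space (S n). \<bar>Y n \<theta> \<omega>\<bar> \<ge> (s n)\<^sup>2 * T n \<theta> \<omega>} \<in> sets (S n)"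
        by measurable
      then have ev: "{\<omega> \<in> space (S n). \<bar>Y n \<theta> \<omega>\<bar> \<ge> (s n)\<^sup>2 * T n \<theta> \<omega>} \<in> events"
        by (simp add: sets_P[OF \<open>\<theta> \<in> \<Theta>\<close>])
      have "diameter (C n \<omega>) < M n * D n \<theta> \<omega>" if "\<bar>Y n \<theta> \<omega>\<bar> < (s n)\<^sup>2 * T n \<theta> \<omega>" for \<omega>
      proof -
        have "diameter (C n \<omega>) \<le> s n * (32 * \<bar>z\<bar> + 16) * D n \<theta> \<omega>"
          unfolding C_def D_def
          by (rule diameter_conf_set_le[OF sigma \<open>\<theta> \<in> \<Theta>\<close> k_pos _ sn refl])
            (use bn that in \<open>auto simp: Y_def T_def\<close>)
        \<comment> \<open>For \<open>n = 0\<close> the quotient is \<open>0\<close> and \<open>D\<close> may vanish, so \<open>0 < n\<close> is what gives strictness.\<close>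
        also have "0 < \<sigma>bar * real (k n) powr (1/4) / sqrt (real n)"
          using sigmabar k_pos[of n] n by simp
        then have "0 < D n \<theta> \<omega>"
          using bn norm_ge_zero[of "\<theta> - \<theta>hat n \<omega>"] unfolding D_def by linarith
        then have "s n * (32 * \<bar>z\<bar> + 16) * D n \<theta> \<omega> < s n * (32 * \<bar>z\<bar> + 17) * D n \<theta> \<omega>"
          using sn by (intro mult_strict_right_mono mult_strict_left_mono) auto
        also have "s n * (32 * \<bar>z\<bar> + 17) = M n"
          by (simp add: s_def add_nonneg_pos less_imp_neq[symmetric])
        finally show ?thesis .
      qed
      then have "{\<omega> \<in> space (S n). diameter (C n \<omega>) \<ge> M n * D n \<theta> \<omega>}
          \<subseteq> {\<omega> \<in> space (S n). \<bar>Y n \<theta> \<omega>\<bar> \<ge> (s n)\<^sup>2 * T n \<theta> \<omega>}"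
        by (auto simp: not_less[symmetric])
      then show "ereal (prob {\<omega> \<in> space (S n). diameter (C n \<omega>) \<ge> M n * D n \<theta> \<omega>})
          \<le> ereal (prob {\<omega> \<in> space (S n). \<bar>Y n \<theta> \<omega>\<bar> \<ge> (s n)\<^sup>2 * T n \<theta> \<omega>})"
        using finite_measure_mono[OF _ ev] by simp
    qed
  qed
  moreover have "0 \<le> p n" for n
  proof -
    obtain \<theta> where "\<theta> \<in> \<Theta>" using \<open>\<Theta> \<noteq> {}\<close> by blast
    then show ?thesis unfolding p_def by (rule SUP_upper2) simp
  qed
  ultimately have "p \<longlonglongrightarrow> 0"
    using q by (intro tendsto_sandwich[of "\<lambda>_. 0" p _ q]) auto
  then have "limsup p = 0"
    by (intro lim_imp_Limsup) simp_all
  then show "limsup (\<lambda>n. SUP \<theta>\<in>\<Theta>. ereal (measure (P n \<theta>) {\<omega> \<in> space (S n).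
        diameter (conf_set \<Theta> \<sigma> z (k n) n (B (k n)) (\<theta>hat n \<omega>) (R (k n) n (\<theta>hat n \<omega>) (X n \<omega>)))
          \<ge> M n * (\<sigma>bar * real (k n) powr (1/4) / sqrt (real n) + B (k n) + norm (\<theta> - \<theta>hat n \<omega>))}))
      = 0"
    by (simp add: p_def[abs_def] C_def D_def)
qed

end
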